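(* Let $A,B \subseteq \mathbb{R}$ be finite sets with $|A| \sim |B|$. Then $$|AB+A| \gtrsim |A|^{\frac{3}{2} + \frac{3}{170}}.$$
   Context: $AB+A=\{ab+a' : a,a'\in A,\ b\in B\}$. $X\sim Y$ means $c_1X\le Y\le c_2X$ for absolute constants $0<c_1\le c_2$. The notation $X\gtrsim Y$ means $X \ge c\,Y/(\log |A|)^{C}$ for absolute constants $c,C>0$ (logarithmic factors are suppressed). *)

theory Defs
  imports Complex_Main "HOL-Library.Set_Algebras"
begin

end

theory Submission
  imports Defs "HOL-Analysis.Convex" "HOL-Analysis.Harmonic_Numbers"
begin

text \<open>
  Write \<open>C = A B + A\<close>, \<open>n = |A|\<close> and let \<open>f\<close> count the representations of a real number as a difference of two
  elements of \<open>A\<close>. The Szemeredi--Trotter bound is needed only for grids, where cutting the grid into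
  cells proves it. It is applied three times.

  If \<open>d\<close> is a difference with \<open>f d \<ge> k\<close>, then by Elekes' argument the sets \<open>A + b A\<^sub>d\<close>, where \<open>b \<in> B\<close> and
  \<open>A\<^sub>d = A \<inter> (A + d)\<close>, have total size at least of order \<open>n\<^sup>2 k\<^bsup>1/2\<^esup>\<close>; each of their elements \<open>c\<close>
  gives a pair \<open>c, c - b d\<close> in \<open>C\<close>, and hence there are at most of order \<open>|C|\<^sup>4 n\<^bsup>-4\<^esup> k\<^bsup>-3/2\<^esup>\<close> such
  differences. On the other hand, Cauchy--Schwarz gives at least \<open>n\<^sup>6 / |C|\<close> solutions of
  \<open>b a - b' a' = e - e'\<close>, so \<open>f\<close> is large on average over the differences \<open>b a - b' a'\<close>, while a set \<open>X\<close>
  contains at most of order \<open>n\<^sup>3 |X|\<^bsup>2/3\<^esup>\<close> of these. Summing over \<open>k\<close> yields \<open>|C|\<close> at least of order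
  \<open>n\<^bsup>17/11\<^esup>\<close> up to a logarithm, and \<open>17/11 = 3/2 + 1/22 > 3/2 + 3/170\<close>.
\<close>

section \<open>Incidences of lines with a Cartesian grid\<close>

text \<open>The least points of the fibres of \<open>f\<close> inject into the image. Every other
  point \<open>x\<close> is charged to the collision formed by \<open>x\<close> and a smaller point
  of its fibre, and is recovered as the larger member of that pair.\<close>

lemma card_le_card_image_plus_collisions:
  fixes X :: "'a::linorder set"
  assumes "finite X"
  shows "card X \<le> card (f ` X) + card {(x, x'). x \<in> X \<and> x' \<in> X \<and> x < x' \<and> f x = f x'}"
proof -
  let ?C = "{(x, x'). x \<in> X \<and> x' \<in> X \<and> x < x' \<and> f x = f x'}"
  define R where "R = {x \<in> X. \<forall>x'\<in>X. x' < x \<longrightarrow> f x' \<noteq> f x}"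
  have "inj_on f R"
    unfolding R_def inj_on_def by (metis (mono_tags, lifting) linorder_neqE mem_Collect_eq)
  then have "card R \<le> card (f ` X)"
    by (rule card_inj_on_le) (use assms in \<open>auto simp: R_def\<close>)
  moreover have "card (X - R) \<le> card ?C"
  proof -
    have "\<forall>x\<in>X - R. \<exists>x'\<in>X. x' < x \<and> f x' = f x"
      by (auto simp: R_def)
    then obtain g where g: "\<And>x. x \<in> X - R \<Longrightarrow> g x \<in> X \<and> g x < x \<and> f (g x) = f x"
      by metis
    have "finite ?C"
      by (rule finite_subset[of _ "X \<times> X"]) (use assms in auto)
    moreover have "inj_on (\<lambda>x. (g x, x)) (X - R)"
      by (auto simp: inj_on_def)
    ultimately show ?thesis
      by (rule_tac f = "\<lambda>x. (g x, x)" in card_inj_on_le) (use g in auto)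
  qed
  moreover have "card X = card R + card (X - R)"
    using assms by (subst card_Un_disjoint[symmetric]) (auto simp: R_def intro: arg_cong[where f = card])
  ultimately show ?thesis by linarith
qed

text \<open>Cutting \<open>P\<close> into runs of \<open>w\<close> consecutive points by rank does
  this: the ranks in one block lie in a window of \<open>w\<close> integers, so each point shares
  its block with at most \<open>w - 1\<close> others.\<close>

lemma block_partition_exists:
  fixes P :: "'a::linorder set" and s :: real
  assumes "finite P" "s > 0"
  obtains blk :: "'a \<Rightarrow> nat" where
    "\<And>x y. x \<in> P \<Longrightarrow> y \<in> P \<Longrightarrow> x \<le> y \<Longrightarrow> blk x \<le> blk y"
    "\<And>x. x \<in> P \<Longrightarrow> real (blk x) \<le> s"
    "real (card {(x, y). x \<in> P \<and> y \<in> P \<and> x \<noteq> y \<and> blk x = blk y}) \<le> real (card P) ^ 2 / s"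
proof -
  define rk where "rk = (\<lambda>x. card {p \<in> P. p < x})"
  \<comment> \<open>The width exceeds |P|/s, which keeps the block indices at most \<open>s\<close>,
    while \<open>w - 1\<close> is still at most |P|/s, which bounds the pairs inside blocks.\<close>
  define w where "w = nat \<lfloor>real (card P) / s\<rfloor> + 1"
  define blk where "blk = (\<lambda>x. rk x div w)"
  have w0: "w > 0" by (simp add: w_def)
  have q0: "real (card P) / s \<ge> 0" using assms by simp
  have w1: "real (card P) / s \<le> real w" "real (w - 1) \<le> real (card P) / s"
    using q0 by (simp_all add: w_def) linarith+
  have rk_mono: "rk x \<le> rk y" if "x \<le> y" for x y
    unfolding rk_def by (rule card_mono) (use assms that in auto)
  have rk_strict: "rk x < rk y" if "x \<in> P" "x < y" for x y
    unfolding rk_def by (rule psubset_card_mono) (use assms that in auto)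
  have rk_inj: "inj_on rk P"
    by (rule inj_onI) (metis less_irrefl linorder_neqE rk_strict)
  have rk_le: "rk x \<le> card P" for x
    unfolding rk_def by (rule card_mono) (use assms in auto)
  show ?thesis
  proof
    show "blk x \<le> blk y" if "x \<in> P" "y \<in> P" "x \<le> y" for x y
      using rk_mono[OF that(3)] by (simp add: blk_def div_le_mono)
    show "real (blk x) \<le> s" if "x \<in> P" for x
    proof -
      have "real (blk x) \<le> real (rk x) / real w"
        unfolding blk_def by (rule of_nat_div_le_of_nat)
      also have "\<dots> \<le> real (card P) / real w"
        using rk_le by (simp add: divide_right_mono)
      also have "\<dots> \<le> s"
        using w1(1) w0 assms(2) by (simp add: field_simps)
      finally show ?thesis .
    qed
    have fib: "card {y \<in> P. x \<noteq> y \<and> blk x = blk y} \<le> w - 1" if "x \<in> P" for x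
    proof -
      have "card {y \<in> P. x \<noteq> y \<and> blk x = blk y} \<le> card ({blk x * w ..< blk x * w + w} - {rk x})"
      proof (rule card_inj_on_le)
        show "inj_on rk {y \<in> P. x \<noteq> y \<and> blk x = blk y}"
          using rk_inj by (rule inj_on_subset) auto
        show "rk ` {y \<in> P. x \<noteq> y \<and> blk x = blk y} \<subseteq> {blk x * w ..< blk x * w + w} - {rk x}"
        proof (rule image_subsetI)
          fix y assume y: "y \<in> {y \<in> P. x \<noteq> y \<and> blk x = blk y}"
          then have "rk y \<noteq> rk x" using rk_inj that by (auto simp: inj_on_def)
          moreover have "blk x * w \<le> rk y" "rk y < blk x * w + w"
            using y w0 by (simp_all add: blk_def) (metis add.commute dividend_less_times_div mult.commute)
          ultimately show "rk y \<in> {blk x * w ..< blk x * w + w} - {rk x}" by simp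
        qed
      qed simp
      also have "\<dots> = w - 1"
      proof -
        have "blk x * w \<le> rk x" "rk x < blk x * w + w"
          using w0 by (simp_all add: blk_def) (metis add.commute dividend_less_times_div mult.commute)
        then show ?thesis by simp
      qed
      finally show ?thesis .
    qed
    have "{(x, y). x \<in> P \<and> y \<in> P \<and> x \<noteq> y \<and> blk x = blk y}
        = Sigma P (\<lambda>x. {y \<in> P. x \<noteq> y \<and> blk x = blk y})" by auto
    then have "card {(x, y). x \<in> P \<and> y \<in> P \<and> x \<noteq> y \<and> blk x = blk y}
        = (\<Sum>x\<in>P. card {y \<in> P. x \<noteq> y \<and> blk x = blk y})"
      using assms by (simp add: card_SigmaI)
    also have "\<dots> \<le> (\<Sum>x\<in>P. w - 1)" by (rule sum_mono) (rule fib)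
    also have "\<dots> = card P * (w - 1)" by simp
    finally have "real (card {(x, y). x \<in> P \<and> y \<in> P \<and> x \<noteq> y \<and> blk x = blk y})
        \<le> real (card P) * real (w - 1)"
      unfolding of_nat_mult[symmetric] of_nat_le_iff .
    also have "\<dots> \<le> real (card P) * (real (card P) / s)"
      by (rule mult_left_mono) (use w1 in auto)
    finally show "real (card {(x, y). x \<in> P \<and> y \<in> P \<and> x \<noteq> y \<and> blk x = blk y})
        \<le> real (card P) ^ 2 / s"
      by (simp add: power2_eq_square)
  qed
qed

text \<open>A pair \<open>(m, c)\<close> stands for the line \<open>y = m x + c\<close>.\<close>

definition incidences :: "real set \<Rightarrow> real set \<Rightarrow> (real \<times> real) set \<Rightarrow> ((real \<times> real) \<times> real) set" where
  "incidences P Q L = {(l, x). l \<in> L \<and> x \<in> P \<and> fst l * x + snd l \<in> Q}"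

text \<open>A line of nonzero slope meets at most \<open>2 * k + 1\<close> cells, which pays for one
  incidence per cell. Its surplus is bounded by the pairs of its points in a common cell. Two points
  determine the line, so over all lines these pairs number at most the pairs of grid points that
  share a cell and differ in both coordinates.\<close>

lemma incidences_le_cells:
  fixes s :: real
  assumes fin: "finite P" "finite Q" "finite L" and slope: "\<And>l. l \<in> L \<Longrightarrow> fst l \<noteq> 0" and "s > 0"
  shows "real (card (incidences P Q L)) \<le> (2 * s + 1) * card L + (real (card P) * card Q) ^ 2 / s ^ 2"
proof -
  obtain u where u: "\<And>x y. x \<in> P \<Longrightarrow> y \<in> P \<Longrightarrow> x \<le> y \<Longrightarrow> u x \<le> u y"
    "\<And>x. x \<in> P \<Longrightarrow> real (u x) \<le> s"
    "real (card {(x, y). x \<in> P \<and> y \<in> P \<and> x \<noteq> y \<and> u x = u y}) \<le> real (card P) ^ 2 / s"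
    using block_partition_exists[OF fin(1) \<open>s > 0\<close>] by blast
  obtain v where v: "\<And>x y. x \<in> Q \<Longrightarrow> y \<in> Q \<Longrightarrow> x \<le> y \<Longrightarrow> v x \<le> v y"
    "\<And>x. x \<in> Q \<Longrightarrow> real (v x) \<le> s"
    "real (card {(x, y). x \<in> Q \<and> y \<in> Q \<and> x \<noteq> y \<and> v x = v y}) \<le> real (card Q) ^ 2 / s"
    using block_partition_exists[OF fin(2) \<open>s > 0\<close>] by blast
  \<comment> \<open>The integer part of \<open>s\<close> bounds all block indices, so the
    natural-number subtraction \<open>k - v (m * x + c)\<close> below never truncates.\<close>
  define k where "k = nat \<lfloor>s\<rfloor>"
  have uk: "u x \<le> k" if "x \<in> P" for x using u(2)[OF that] by (simp add: k_def le_nat_floor)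
  have vk: "v x \<le> k" if "x \<in> Q" for x using v(2)[OF that] by (simp add: k_def le_nat_floor)
  have ks: "real k \<le> s" using \<open>s > 0\<close> by (simp add: k_def)
  define X where "X = (\<lambda>l. {x \<in> P. fst l * x + snd l \<in> Q})"
  define E where "E = (\<lambda>l. {(x, x'). x \<in> X l \<and> x' \<in> X l \<and> x < x' \<and> u x = u x'
      \<and> v (fst l * x + snd l) = v (fst l * x' + snd l)})"
  have finX: "finite (X l)" for l using fin by (simp add: X_def)
  have finE: "finite (E l)" for l
    by (rule finite_subset[of _ "X l \<times> X l"]) (use finX in \<open>auto simp: E_def\<close>)
  have line: "card (X l) \<le> (2 * k + 1) + card (E l)" if "l \<in> L" for l
  proof -
    obtain m c where l: "l = (m, c)" by force
    text \<open>A monotone curve crosses the cells of a grid in a chain, which the sum (or difference) of the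
      block coordinates enumerates injectively.\<close>
    define \<psi> where "\<psi> = (\<lambda>x. if m > 0 then u x + v (m * x + c) else u x + (k - v (m * x + c)))"
    have "m \<noteq> 0" using slope[OF that] l by simp
    have "card (X l) \<le> card (\<psi> ` X l)
        + card {(x, x'). x \<in> X l \<and> x' \<in> X l \<and> x < x' \<and> \<psi> x = \<psi> x'}"
      by (rule card_le_card_image_plus_collisions[OF finX])
    moreover have "card (\<psi> ` X l) \<le> card {0..2 * k}"
    proof (rule card_mono)
      show "\<psi> ` X l \<subseteq> {0..2 * k}"
      proof (rule image_subsetI)
        fix x assume "x \<in> X l"
        then have "u x \<le> k" "v (m * x + c) \<le> k" using uk vk by (auto simp: X_def l)
        then show "\<psi> x \<in> {0..2 * k}" by (auto simp: \<psi>_def)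
      qed
    qed simp
    moreover have "card {(x, x'). x \<in> X l \<and> x' \<in> X l \<and> x < x' \<and> \<psi> x = \<psi> x'} \<le> card (E l)"
    proof (rule card_mono[OF finE], rule subsetI, clarify)
      fix x x' assume h: "x \<in> X l" "x' \<in> X l" "x < x'" "\<psi> x = \<psi> x'"
      then have a: "u x \<le> u x'" "v (m * x + c) \<le> k" "v (m * x' + c) \<le> k"
        using u(1) vk by (auto simp: X_def l)
      \<comment> \<open>Both summands of \<open>\<psi>\<close> are weakly increasing in
        \<open>x\<close>, so equal sums force equal summands.\<close>
      have "u x = u x' \<and> v (m * x + c) = v (m * x' + c)"
      proof (cases "m > 0")
        case True
        then have "v (m * x + c) \<le> v (m * x' + c)"
          using h by (intro v(1)) (auto simp: X_def l)
        then show ?thesis using True h(4) a by (simp add: \<psi>_def)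
      next
        case False
        then have "v (m * x' + c) \<le> v (m * x + c)"
          using h \<open>m \<noteq> 0\<close> by (intro v(1)) (auto simp: X_def l)
        moreover have "u x + (k - v (m * x + c)) = u x' + (k - v (m * x' + c))"
          using h(4) False by (simp add: \<psi>_def)
        ultimately show ?thesis using a by linarith
      qed
      then show "(x, x') \<in> E l" using h by (auto simp: E_def l)
    qed
    ultimately show ?thesis by simp
  qed
  let ?PP = "{(x, y). x \<in> P \<and> y \<in> P \<and> x \<noteq> y \<and> u x = u y}"
  let ?QQ = "{(x, y). x \<in> Q \<and> y \<in> Q \<and> x \<noteq> y \<and> v x = v y}"
  have finPQ: "finite ?PP" "finite ?QQ"
    by (rule finite_subset[of _ "P \<times> P"], use fin in auto, rule finite_subset[of _ "Q \<times> Q"], use fin in auto)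
  have "card (Sigma L E) \<le> card (?PP \<times> ?QQ)"
  proof (rule card_inj_on_le)
    let ?g = "\<lambda>(l, x, x'). ((x, x'), (fst l * x + snd l, fst l * x' + snd l)) :: (real \<times> real) \<times> (real \<times> real)"
    show "inj_on ?g (Sigma L E)"
    proof (rule inj_onI, clarsimp simp: E_def)
      fix m c m' c' x x' :: real
      assume h: "x < x'" "m * x + c = m' * x + c'" "m * x' + c = m' * x' + c'"
      have "(m - m') * (x' - x) = 0" using h(2,3) by (simp add: algebra_simps)
      then have "m = m'" using h(1) by simp
      then show "m = m' \<and> c = c'" using h(2) by simp
    qed
    show "?g ` Sigma L E \<subseteq> ?PP \<times> ?QQ"
      using slope by (auto simp: E_def X_def)
    show "finite (?PP \<times> ?QQ)" using finPQ by simp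
  qed
  then have "real (card (Sigma L E)) \<le> real (card ?PP) * real (card ?QQ)"
    unfolding of_nat_mult[symmetric] of_nat_le_iff card_cartesian_product .
  also have "\<dots> \<le> (real (card P) ^ 2 / s) * (real (card Q) ^ 2 / s)"
    by (rule mult_mono) (use u(3) v(3) \<open>s > 0\<close> in auto)
  finally have pairs: "real (card (Sigma L E)) \<le> (real (card P) * card Q) ^ 2 / s ^ 2"
    by (simp add: power2_eq_square algebra_simps)
  have "incidences P Q L = Sigma L X" by (auto simp: incidences_def X_def)
  then have "real (card (incidences P Q L)) = (\<Sum>l\<in>L. real (card (X l)))"
    using fin finX by simp
  also have "\<dots> \<le> (\<Sum>l\<in>L. (2 * real k + 1) + real (card (E l)))"
  proof (rule sum_mono)
    fix l assume "l \<in> L"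
    from line[OF this] show "real (card (X l)) \<le> (2 * real k + 1) + real (card (E l))" by linarith
  qed
  also have "\<dots> = (2 * real k + 1) * card L + card (Sigma L E)"
    using fin finE by (simp add: sum.distrib)
  finally have "real (card (incidences P Q L)) \<le> (2 * real k + 1) * card L + card (Sigma L E)" .
  also have "\<dots> \<le> (2 * s + 1) * card L + (real (card P) * card Q) ^ 2 / s ^ 2"
    by (intro add_mono mult_right_mono pairs) (use ks in auto)
  finally show ?thesis .
qed

text \<open>This is the bound (|P||Q||L|)^(2/3) + |L| up to constants, cubed to avoid fractional
  exponents. It follows from the cell estimate by optimising \<open>s\<close>.\<close>

theorem szemeredi_trotter_grid:
  assumes fin: "finite P" "finite Q" "finite L" and slope: "\<And>l. l \<in> L \<Longrightarrow> fst l \<noteq> 0"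
  shows "real (card (incidences P Q L)) ^ 3 \<le> 72 * (real (card P) * card Q * card L) ^ 2
    \<or> real (card (incidences P Q L)) \<le> 6 * card L"
proof (rule disjCI)
  define I where "I = real (card (incidences P Q L))"
  define l where "l = real (card L)"
  define r where "r = (real (card P) * card Q) ^ 2"
  assume "\<not> real (card (incidences P Q L)) \<le> 6 * card L"
  then have I: "I > 6 * l" by (simp add: I_def l_def)
  have "l \<noteq> 0"
  proof
    assume "l = 0"
    then have "L = {}" using fin by (simp add: l_def)
    then show False using I by (simp add: I_def l_def incidences_def)
  qed
  then have l: "l > 0" by (simp add: l_def)
  then have Ipos: "I > 0" using I by simp
  \<comment> \<open>The value I/(6l) is the choice of \<open>s\<close>: since it is at least 1, (2s
    + 1) l \<le> 3 s l = I/2, and this half of the incidences is absorbed on the left. The excluded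
    case I \<le> 6l is where this choice drops below 1.\<close>
  have s1: "I / (6 * l) \<ge> 1" using I l by simp
  have "I \<le> (2 * (I / (6 * l)) + 1) * l + r / (I / (6 * l)) ^ 2"
    unfolding I_def l_def r_def using s1 unfolding I_def l_def
    by (intro incidences_le_cells fin slope) auto
  also have "\<dots> \<le> (3 * (I / (6 * l))) * l + r / (I / (6 * l)) ^ 2"
  proof (intro add_mono mult_right_mono)
    show "2 * (I / (6 * l)) + 1 \<le> 3 * (I / (6 * l))" using s1 by linarith
  qed (use l in auto)
  also have "\<dots> = I / 2 + 36 * l ^ 2 * r / I ^ 2"
    using l Ipos by (simp add: field_simps power2_eq_square)
  finally have "I / 2 \<le> 36 * l ^ 2 * r / I ^ 2" by simp
  then have "I ^ 3 \<le> 72 * (l ^ 2 * r)"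
    using Ipos by (simp add: field_simps power3_eq_cube power2_eq_square)
  then show "real (card (incidences P Q L)) ^ 3 \<le> 72 * (real (card P) * card Q * card L) ^ 2"
    by (simp add: I_def l_def r_def power_mult_distrib algebra_simps)
qed

section \<open>Sums of dilates and popular differences\<close>

text \<open>Elekes' argument: for c = a + b a' the line y = -b x + c passes through (a', a) in A' x
  A. Every triple (b, a, a') is thus an incidence, while the number of lines is the sum
  \<open>Y\<close> to be bounded below.\<close>

lemma sum_card_dilates_lower:
  fixes A A' B :: "real set"
  assumes fin: "finite A" "finite A'" "finite B" and "0 \<notin> B" and "card B \<le> card A"
  shows "real (card A) * card B ^ 3 * card A'
    \<le> 72 * (\<Sum>b\<in>B. real (card ((\<lambda>(a, a'). a + b * a') ` (A \<times> A')))) ^ 2"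
proof -
  define S where "S = (\<lambda>b. (\<lambda>(a, a'). a + b * a') ` (A \<times> A'))"
  define L where "L = (\<lambda>(b, c). (- b, c)) ` (Sigma B S)"
  define Y where "Y = (\<Sum>b\<in>B. real (card (S b)))"
  define n m t where "n = real (card A)" and "m = real (card B)" and "t = real (card A')"
  have finS: "finite (S b)" for b using fin by (simp add: S_def)
  have finL: "finite L" using fin finS by (auto simp: L_def)
  have "card L = card (Sigma B S)"
    unfolding L_def by (rule card_image) (auto simp: inj_on_def)
  have slope: "fst l \<noteq> 0" if "l \<in> L" for l using that \<open>0 \<notin> B\<close> by (auto simp: L_def)
  from \<open>card L = card (Sigma B S)\<close> have cardL: "real (card L) = Y"
    using fin finS by (simp add: card_SigmaI Y_def)
  have "card (B \<times> A \<times> A') \<le> card (incidences A' A L)"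
  proof (rule card_inj_on_le)
    let ?g = "\<lambda>(b, a, a'). ((- b, a + b * a'), a') :: (real \<times> real) \<times> real"
    show "inj_on ?g (B \<times> A \<times> A')" by (auto simp: inj_on_def)
    show "?g ` (B \<times> A \<times> A') \<subseteq> incidences A' A L"
      by (force simp: incidences_def L_def S_def)
    show "finite (incidences A' A L)"
      by (rule finite_subset[of _ "L \<times> A'"]) (use fin finL in \<open>auto simp: incidences_def\<close>)
  qed
  then have "real (card (B \<times> A \<times> A')) \<le> real (card (incidences A' A L))" by simp
  then have low: "n * m * t \<le> real (card (incidences A' A L))"
    by (simp add: n_def m_def t_def card_cartesian_product algebra_simps)
  have nn: "n \<ge> 0" "m \<ge> 0" "t \<ge> 0" "m \<le> n" "Y \<ge> 0"
    using assms by (auto simp: n_def m_def t_def Y_def intro: sum_nonneg)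
  have st: "real (card (incidences A' A L)) ^ 3 \<le> 72 * (t * n * Y) ^ 2
      \<or> real (card (incidences A' A L)) \<le> 6 * Y"
    using szemeredi_trotter_grid[OF fin(2,1) finL slope] by (simp add: t_def n_def cardL)
  have "n * m ^ 3 * t \<le> 72 * Y ^ 2"
  proof (cases "n = 0 \<or> t = 0")
    case True
    then show ?thesis by auto
  next
    case False
    then have pos: "n > 0" "t \<ge> 1" using nn by (auto simp: t_def)
    from st show ?thesis
    proof
      assume "real (card (incidences A' A L)) ^ 3 \<le> 72 * (t * n * Y) ^ 2"
      moreover have "(n * m * t) ^ 3 \<le> real (card (incidences A' A L)) ^ 3"
        using low nn by (intro power_mono) auto
      ultimately have "(n * m * t) ^ 3 \<le> 72 * (t * n * Y) ^ 2" by linarith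
      then have "(n * t) ^ 2 * (n * m ^ 3 * t) \<le> (n * t) ^ 2 * (72 * Y ^ 2)"
        by (simp add: power2_eq_square power3_eq_cube algebra_simps)
      then show ?thesis
        by (rule mult_left_le_imp_le) (use pos in simp)
    next
      assume "real (card (incidences A' A L)) \<le> 6 * Y"
      then have "n * m * t \<le> 6 * Y" using low by linarith
      then have "(n * m * t) ^ 2 \<le> (6 * Y) ^ 2" using nn by (intro power_mono) auto
      \<comment> \<open>When the linear term of the incidence bound dominates, the claim reduces to
        m \<le> n t, which holds because m \<le> n and t \<ge> 1.\<close>
      moreover have "n * m ^ 3 * t \<le> (n * m * t) ^ 2"
      proof -
        have "(n * m ^ 2 * t) * m \<le> (n * m ^ 2 * t) * (n * t)"
          using nn pos mult_mono[of m n 1 t] by (intro mult_left_mono) auto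
        then show ?thesis by (simp add: power2_eq_square power3_eq_cube algebra_simps)
      qed
      moreover have "(6 * Y) ^ 2 \<le> 72 * Y ^ 2" by (simp add: power_mult_distrib)
      ultimately show ?thesis by linarith
    qed
  qed
  then show ?thesis by (simp add: n_def m_def t_def Y_def S_def)
qed

definition difference_reps :: "real set \<Rightarrow> real \<Rightarrow> nat" where
  "difference_reps A x = card {(a, a'). a \<in> A \<and> a' \<in> A \<and> a - a' = x}"

text \<open>The difference 0 is left out because the negated members serve as slopes of lines; its
  contribution to the collisions is counted separately.\<close>

definition popular_differences :: "real set \<Rightarrow> nat \<Rightarrow> real set" where
  "popular_differences A k = {x. x \<noteq> 0 \<and> k \<le> difference_reps A x}"

lemma difference_reps_eq_card_translate:
  "difference_reps A d = card {a \<in> A. a - d \<in> A}"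
proof -
  have "bij_betw (\<lambda>a. (a, a - d)) {a \<in> A. a - d \<in> A} {(a, a'). a \<in> A \<and> a' \<in> A \<and> a - a' = d}"
    by (rule bij_betwI[where g = fst]) auto
  then show ?thesis by (simp add: difference_reps_def bij_betw_same_card)
qed

lemma difference_reps_le_card: "finite A \<Longrightarrow> difference_reps A d \<le> card A"
  by (simp add: difference_reps_eq_card_translate card_mono)

lemma popular_differences_subset:
  assumes "k \<ge> 1"
  shows "popular_differences A k \<subseteq> (\<lambda>(a, a'). a - a') ` (A \<times> A)"
proof
  fix x assume "x \<in> popular_differences A k"
  then have "difference_reps A x \<noteq> 0" using assms by (auto simp: popular_differences_def)
  then have "{(a, a'). a \<in> A \<and> a' \<in> A \<and> a - a' = x} \<noteq> {}"
    unfolding difference_reps_def by (metis card.empty)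
  then show "x \<in> (\<lambda>(a, a'). a - a') ` (A \<times> A)" by auto
qed

lemma finite_popular_differences:
  "finite A \<Longrightarrow> k \<ge> 1 \<Longrightarrow> finite (popular_differences A k)"
  by (rule finite_subset[OF popular_differences_subset]) auto

lemma card_popular_differences_le:
  assumes "finite A" "k \<ge> 1"
  shows "card (popular_differences A k) \<le> card A ^ 2"
proof -
  have "card (popular_differences A k) \<le> card ((\<lambda>(a, a'). a - a') ` (A \<times> A))"
    by (rule card_mono[OF _ popular_differences_subset]) (use assms in auto)
  also have "\<dots> \<le> card (A \<times> A)" by (rule card_image_le) (use assms in auto)
  finally show ?thesis by (simp add: card_cartesian_product power2_eq_square)
qed

text \<open>If c = a + b a' with a' and a' - d both in A, then c and c - d b = a + b (a' - d) lie in
  \<open>C\<close>, so the line y = -d x + c meets the grid B x C above b. The previous lower bound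
  on sums of dilates makes such incidences numerous, while there are only |D||C| lines. The second
  alternative forces |C| to be at least of order |A|^2 when |A| and |B| are comparable.\<close>

lemma card_popular_differences_bound:
  fixes A B :: "real set"
  defines "n \<equiv> real (card A)" and "m \<equiv> real (card B)" and "N \<equiv> real (card (A * B + A))"
  assumes fin: "finite A" "finite B" and "0 \<notin> B" "B \<noteq> {}" "card B \<le> card A" and k: "k \<ge> 1"
  shows "real (card (popular_differences A k)) ^ 2 * n ^ 3 * m ^ 5 * real k ^ 3 \<le> 72 ^ 5 * N ^ 8
    \<or> n * m ^ 3 * k \<le> 2592 * N ^ 2"
proof (cases "popular_differences A k = {}")
  case True
  then show ?thesis by (simp add: N_def)
next
  case False
  define D where "D = popular_differences A k"
  define C where "C = A * B + A"
  define A' where "A' = (\<lambda>d. {a \<in> A. a - d \<in> A})"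
  define S where "S = (\<lambda>d b. (\<lambda>(a, a'). a + b * a') ` (A \<times> A' d))"
  define L where "L = (\<lambda>(d, c). (- d, c)) ` (D \<times> C)"
  \<comment> \<open>This is the lower bound that the sums of dilates give uniformly in
    \<open>d\<close>, since \<open>A' d\<close> has at least \<open>k\<close> elements.\<close>
  define y where "y = sqrt (n * m ^ 3 * k / 72)"
  have finD: "finite D" using finite_popular_differences fin k by (simp add: D_def)
  have finC: "finite C" unfolding C_def using fin by (intro finite_set_plus finite_set_times)
  have finL: "finite L" using finD finC by (simp add: L_def)
  have finA': "finite (A' d)" for d using fin by (simp add: A'_def)
  have finS: "finite (S d b)" for d b using fin finA' by (simp add: S_def)
  have nn: "n \<ge> 0" "m > 0" "N \<ge> 0" "y \<ge> 0" using assms by (auto simp: card_gt_0_iff y_def)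
  have y2: "y ^ 2 = n * m ^ 3 * k / 72" using nn by (simp add: y_def)
  have Dpos: "real (card D) > 0" using False finD by (simp add: D_def card_gt_0_iff)
  have D0: "d \<noteq> 0" "card (A' d) \<ge> k" if "d \<in> D" for d
    using that by (auto simp: D_def popular_differences_def difference_reps_eq_card_translate A'_def)
  have Y: "y \<le> (\<Sum>b\<in>B. real (card (S d b)))" if "d \<in> D" for d
  proof -
    have "n * m ^ 3 * k \<le> n * m ^ 3 * card (A' d)"
      using D0[OF that] nn by (intro mult_left_mono) auto
    also have "\<dots> \<le> 72 * (\<Sum>b\<in>B. real (card (S d b))) ^ 2"
      using sum_card_dilates_lower[OF fin(1) finA' fin(2) \<open>0 \<notin> B\<close> \<open>card B \<le> card A\<close>]
      by (simp add: n_def m_def S_def)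
    finally have "y ^ 2 \<le> (\<Sum>b\<in>B. real (card (S d b))) ^ 2" using y2 by simp
    then show ?thesis by (rule power2_le_imp_le) (simp add: sum_nonneg)
  qed
  have slope: "fst l \<noteq> 0" if "l \<in> L" for l using that D0 by (auto simp: L_def)
  have cardL: "real (card L) = card D * N"
  proof -
    have "card L = card (D \<times> C)"
      unfolding L_def by (rule card_image) (auto simp: inj_on_def)
    then show ?thesis by (simp add: card_cartesian_product N_def C_def)
  qed
  have "card (Sigma D (\<lambda>d. Sigma B (S d))) \<le> card (incidences B C L)"
  proof (rule card_inj_on_le)
    let ?g = "\<lambda>(d, b, c). ((- d, c), b) :: (real \<times> real) \<times> real"
    show "inj_on ?g (Sigma D (\<lambda>d. Sigma B (S d)))" by (auto simp: inj_on_def)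
    show "?g ` (Sigma D (\<lambda>d. Sigma B (S d))) \<subseteq> incidences B C L"
    proof (rule image_subsetI, clarify)
      fix d b c assume h: "d \<in> D" "b \<in> B" "c \<in> S d b"
      then obtain a a' where c: "c = a + b * a'" "a \<in> A" "a' \<in> A" "a' - d \<in> A"
        by (auto simp: S_def A'_def)
      have "a' * b + a \<in> C" "(a' - d) * b + a \<in> C"
        unfolding C_def using c h by (auto intro!: set_plus_intro set_times_intro)
      then have "c \<in> C" "- d * b + c \<in> C" using c(1) by (simp_all add: algebra_simps)
      then show "((- d, c), b) \<in> incidences B C L"
        using h by (auto simp: incidences_def L_def)
    qed
    show "finite (incidences B C L)"
      by (rule finite_subset[of _ "L \<times> B"]) (use fin finL in \<open>auto simp: incidences_def\<close>)
  qed
  moreover have "real (card (Sigma D (\<lambda>d. Sigma B (S d)))) = (\<Sum>d\<in>D. \<Sum>b\<in>B. real (card (S d b)))"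
    using finD fin finS by (simp add: card_SigmaI)
  moreover have "(\<Sum>d\<in>D. \<Sum>b\<in>B. real (card (S d b))) \<ge> (\<Sum>d\<in>D. y)"
    by (rule sum_mono) (rule Y)
  ultimately have low: "card D * y \<le> real (card (incidences B C L))" by simp
  have st: "real (card (incidences B C L)) ^ 3 \<le> 72 * (m * N * (card D * N)) ^ 2
      \<or> real (card (incidences B C L)) \<le> 6 * (card D * N)"
    using szemeredi_trotter_grid[OF fin(2) finC finL slope] cardL
    by (simp add: m_def N_def flip: C_def)
  then show ?thesis
  proof
    assume "real (card (incidences B C L)) ^ 3 \<le> 72 * (m * N * (card D * N)) ^ 2"
    moreover have "(card D * y) ^ 3 \<le> real (card (incidences B C L)) ^ 3"
      using low nn by (intro power_mono) auto
    ultimately have "(card D * y) ^ 3 \<le> 72 * (m * N * (card D * N)) ^ 2" by linarith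
    then have "(card D) ^ 2 * (card D * y ^ 3) \<le> (card D) ^ 2 * (72 * m ^ 2 * N ^ 4)"
      by (simp add: power2_eq_square power3_eq_cube power4_eq_xxxx algebra_simps)
    then have "card D * y ^ 3 \<le> 72 * m ^ 2 * N ^ 4"
      by (rule mult_left_le_imp_le) (use Dpos in simp)
    \<comment> \<open>Squaring turns \<open>y ^ 3\<close> into the cube of \<open>y ^ 2\<close> and
      so removes the square root.\<close>
    then have "(card D * y ^ 3) ^ 2 \<le> (72 * m ^ 2 * N ^ 4) ^ 2"
      using nn by (intro power_mono) auto
    moreover have "(card D * y ^ 3) ^ 2 = card D ^ 2 * (n * m ^ 3 * k / 72) ^ 3"
      unfolding y2[symmetric] by (simp add: power_mult_distrib flip: power_mult)
    ultimately have "card D ^ 2 * (n * m ^ 3 * k / 72) ^ 3 \<le> (72 * m ^ 2 * N ^ 4) ^ 2" by simp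
    then have "m ^ 4 * (card D ^ 2 * n ^ 3 * m ^ 5 * real k ^ 3) \<le> m ^ 4 * (72 ^ 5 * N ^ 8)"
      by (simp add: power_mult_distrib power_divide field_simps flip: power_mult power_add)
    then have "card D ^ 2 * n ^ 3 * m ^ 5 * real k ^ 3 \<le> 72 ^ 5 * N ^ 8"
      by (rule mult_left_le_imp_le) (use nn in simp)
    then show ?thesis by (simp add: D_def)
  next
    assume "real (card (incidences B C L)) \<le> 6 * (card D * N)"
    then have "card D * y \<le> card D * (6 * N)" using low by linarith
    then have "y \<le> 6 * N" by (rule mult_left_le_imp_le) (rule Dpos)
    then have "y ^ 2 \<le> (6 * N) ^ 2" using nn by (intro power_mono) auto
    then show ?thesis using y2 by (simp add: power_mult_distrib)
  qed
qed

section \<open>Collisions of the map (b, a, e) to a b + e\<close>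

text \<open>For fixed b, the equation b a - b' a' = x says that (a', a) lies on the line of slope
  b'/b and intercept x/b. The count is therefore at most the number of incidences of |B||X| lines
  with A x A.\<close>

lemma card_dilated_differences_in_bound:
  fixes A B X :: "real set"
  assumes fin: "finite A" "finite B" "finite X" and "0 \<notin> B" "card B \<le> card A"
    and X: "card X \<le> card A ^ 2" and b: "b \<in> B"
  shows "real (card {(b', a, a'). b' \<in> B \<and> a \<in> A \<and> a' \<in> A \<and> b * a - b' * a' \<in> X}) ^ 3
    \<le> 216 * real (card A) ^ 4 * real (card B) ^ 2 * real (card X) ^ 2"
proof -
  let ?G = "{(b', a, a'). b' \<in> B \<and> a \<in> A \<and> a' \<in> A \<and> b * a - b' * a' \<in> X}"
  define L where "L = (\<lambda>(b', x). (b' / b, x / b)) ` (B \<times> X)"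
  define n m q where "n = real (card A)" and "m = real (card B)" and "q = real (card X)"
  have b0: "b \<noteq> 0" using assms by auto
  have finL: "finite L" using fin by (simp add: L_def)
  have slope: "fst l \<noteq> 0" if "l \<in> L" for l using that \<open>0 \<notin> B\<close> b0 by (auto simp: L_def)
  have "card L = card (B \<times> X)"
    unfolding L_def by (rule card_image) (use b0 in \<open>auto simp: inj_on_def\<close>)
  then have cardL: "real (card L) = m * q" by (simp add: card_cartesian_product m_def q_def)
  have "card ?G \<le> card (incidences A A L)"
  proof (rule card_inj_on_le)
    let ?g = "\<lambda>(b', a, a'). ((b' / b, (b * a - b' * a') / b), a') :: (real \<times> real) \<times> real"
    show "inj_on ?g ?G" using b0 by (auto simp: inj_on_def)
    show "?g ` ?G \<subseteq> incidences A A L"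
    proof (rule image_subsetI, clarify)
      fix b' a a' assume h: "b' \<in> B" "a \<in> A" "a' \<in> A" "b * a - b' * a' \<in> X"
      have "b' / b * a' + (b * a - b' * a') / b = a" using b0 by (simp add: field_simps)
      then show "((b' / b, (b * a - b' * a') / b), a') \<in> incidences A A L"
        using h by (auto simp: incidences_def L_def)
    qed
    show "finite (incidences A A L)"
      by (rule finite_subset[of _ "L \<times> A"]) (use fin finL in \<open>auto simp: incidences_def\<close>)
  qed
  then have low: "real (card ?G) \<le> real (card (incidences A A L))" by simp
  have nn: "n \<ge> 0" "m \<ge> 0" "q \<ge> 0" "m \<le> n" "q \<le> n ^ 2"
    using assms by (auto simp: n_def m_def q_def simp flip: of_nat_power)
  have st: "real (card (incidences A A L)) ^ 3 \<le> 72 * (n * n * (m * q)) ^ 2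
      \<or> real (card (incidences A A L)) \<le> 6 * (m * q)"
    using szemeredi_trotter_grid[OF fin(1,1) finL slope] by (simp add: n_def cardL)
  then have "real (card (incidences A A L)) ^ 3 \<le> 216 * (n * n * (m * q)) ^ 2"
  proof
    assume "real (card (incidences A A L)) \<le> 6 * (m * q)"
    then have "real (card (incidences A A L)) ^ 3 \<le> (6 * (m * q)) ^ 3" by (intro power_mono) auto
    also have "\<dots> = 216 * ((m * q) ^ 2 * (m * q))" by (simp add: power3_eq_cube power2_eq_square)
    \<comment> \<open>The size conditions on \<open>B\<close> and \<open>X\<close> enter here: m q
      \<le> n^3 \<le> n^4 absorbs the linear term of the incidence bound into the main one.\<close>
    also have "\<dots> \<le> 216 * ((m * q) ^ 2 * n ^ 4)"
    proof -
      have "m * q \<le> n * n ^ 2" using nn by (intro mult_mono) auto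
      also have "n * n ^ 2 \<le> n ^ 4"
      proof (cases "card A = 0")
        case False
        then have "n ^ 3 \<le> n ^ 4" by (intro power_increasing) (auto simp: n_def)
        then show ?thesis by (simp add: power3_eq_cube power2_eq_square)
      qed (simp add: n_def)
      finally show ?thesis by (intro mult_left_mono) auto
    qed
    also have "\<dots> = 216 * (n * n * (m * q)) ^ 2"
      by (simp add: power2_eq_square power4_eq_xxxx)
    finally show ?thesis .
  next
    assume h: "real (card (incidences A A L)) ^ 3 \<le> 72 * (n * n * (m * q)) ^ 2"
    have "(n * n * (m * q)) ^ 2 \<ge> 0" by simp
    then show ?thesis using h by linarith
  qed
  moreover have "real (card ?G) ^ 3 \<le> real (card (incidences A A L)) ^ 3"
    using low by (intro power_mono) auto
  ultimately have "real (card ?G) ^ 3 \<le> 216 * (n * n * (m * q)) ^ 2" by linarith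
  also have "\<dots> = 216 * n ^ 4 * m ^ 2 * q ^ 2" by (simp add: power2_eq_square power4_eq_xxxx)
  finally show ?thesis by (simp add: n_def m_def q_def)
qed

text \<open>Cauchy--Schwarz for the fibre sizes of \<open>h\<close> over \<open>C\<close>: they sum
  to |T|, and their squares sum to the number of collisions.\<close>

lemma card_power2_le_collisions:
  assumes fin: "finite T" "finite C" and "h ` T \<subseteq> C"
  shows "card T ^ 2 \<le> card C * card {(t, t'). t \<in> T \<and> t' \<in> T \<and> h t = h t'}"
proof -
  let ?\<rho> = "\<lambda>c. card {t \<in> T. h t = c}"
  have "(\<Sum>c\<in>C. ?\<rho> c) = card T"
    using sum.group[OF fin assms(3), of "\<lambda>_. 1::nat"] by simp
  moreover have "(\<Sum>c\<in>C. real (?\<rho> c)) ^ 2 \<le> real (card C) * (\<Sum>c\<in>C. real (?\<rho> c) ^ 2)"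
    using sum_squared_le_sum_of_squares[of "\<lambda>c. real (?\<rho> c)" C] fin by (simp add: mult.commute)
  moreover have "(\<Sum>c\<in>C. ?\<rho> c ^ 2) = card {(t, t'). t \<in> T \<and> t' \<in> T \<and> h t = h t'}"
  proof -
    have "{(t, t'). t \<in> T \<and> t' \<in> T \<and> h t = h t'} = Sigma T (\<lambda>t. {t' \<in> T. h t' = h t})" by auto
    then have "card {(t, t'). t \<in> T \<and> t' \<in> T \<and> h t = h t'} = (\<Sum>t\<in>T. ?\<rho> (h t))"
      using fin by (simp add: card_SigmaI)
    also have "\<dots> = (\<Sum>c\<in>C. \<Sum>t\<in>{t \<in> T. h t = c}. ?\<rho> (h t))"
      using sum.group[OF fin assms(3), of "\<lambda>t. ?\<rho> (h t)"] by simp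
    also have "\<dots> = (\<Sum>c\<in>C. ?\<rho> c ^ 2)" by (simp add: power2_eq_square)
    finally show ?thesis by simp
  qed
  ultimately show ?thesis
    unfolding of_nat_sum[symmetric] of_nat_power[symmetric] of_nat_mult[symmetric] of_nat_le_iff by simp
qed

text \<open>A collision a b + e = a' b' + e' reads b a - b' a' = e' - e, so a quadruple (b, b', a,
  a') accounts for as many collisions as b a - b' a' has representations as a difference. Splitting
  this multiplicity into levels \<open>k\<close> turns the total into counts of quadruples that hit
  popular differences. The first summand pays for the value 0.\<close>

lemma collisions_le_sum_popular:
  fixes A B :: "real set"
  assumes fin: "finite A" "finite B" and "0 \<notin> B"
  shows "card {(t, t'). t \<in> B \<times> A \<times> A \<and> t' \<in> B \<times> A \<times> A
        \<and> (case t of (b, a, e) \<Rightarrow> a * b + e) = (case t' of (b, a, e) \<Rightarrow> a * b + e)}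
    \<le> card B ^ 2 * card A ^ 2 + (\<Sum>k=1..card A. \<Sum>b\<in>B.
        card {(b', a, a'). b' \<in> B \<and> a \<in> A \<and> a' \<in> A \<and> b * a - b' * a' \<in> popular_differences A k})"
    (is "card ?K \<le> _ + (\<Sum>k=1..card A. \<Sum>b\<in>B. card (?G k b))")
proof -
  let ?n = "card A"
  define V where "V = B \<times> B \<times> A \<times> A"
  define x where "x = (\<lambda>(b, b', a, a'). b * a - b' * a' :: real)"
  have finV: "finite V" using fin by (simp add: V_def)
  have finR: "finite {(e, e'). e \<in> A \<and> e' \<in> A \<and> e - e' = y}" for y
    by (rule finite_subset[of _ "A \<times> A"]) (use fin in auto)
  have "card ?K \<le> card (Sigma V (\<lambda>q. {(e, e'). e \<in> A \<and> e' \<in> A \<and> e - e' = x q}))"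
  proof (rule card_inj_on_le)
    let ?g = "\<lambda>((b, a, e), (b', a', e')). ((b, b', a, a'), (e', e))"
    show "inj_on ?g ?K" by (auto simp: inj_on_def)
    show "?g ` ?K \<subseteq> Sigma V (\<lambda>q. {(e, e'). e \<in> A \<and> e' \<in> A \<and> e - e' = x q})"
      by (auto simp: V_def x_def algebra_simps)
    show "finite (Sigma V (\<lambda>q. {(e, e'). e \<in> A \<and> e' \<in> A \<and> e - e' = x q}))"
      using finV finR by blast
  qed
  also have "\<dots> = (\<Sum>q\<in>V. difference_reps A (x q))"
    using finV finR by (subst card_SigmaI) (auto simp: difference_reps_def)
  \<comment> \<open>Layer-cake formula: a multiplicity is the number of levels \<open>k\<close> not
    exceeding it, and no multiplicity exceeds |A|.\<close>
  also have "\<dots> = (\<Sum>q\<in>V. \<Sum>k=1..?n. of_bool (k \<le> difference_reps A (x q)))"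
  proof (rule sum.cong[OF refl])
    fix q
    have "{k \<in> {1..?n}. k \<le> difference_reps A (x q)} = {1..difference_reps A (x q)}"
      using difference_reps_le_card[OF fin(1)] by (auto intro: order_trans)
    then show "difference_reps A (x q) = (\<Sum>k=1..?n. of_bool (k \<le> difference_reps A (x q)))"
      by (simp add: sum_of_bool_eq Int_def conj_commute)
  qed
  also have "\<dots> = (\<Sum>k=1..?n. \<Sum>q\<in>V. of_bool (k \<le> difference_reps A (x q)))"
    by (rule sum.swap)
  also have "\<dots> \<le> (\<Sum>k=1..?n. card B ^ 2 * ?n + (\<Sum>b\<in>B. card (?G k b)))"
  proof (rule sum_mono)
    fix k assume "k \<in> {1..?n}"
    have finG: "finite (?G k b)" for b
      by (rule finite_subset[of _ "B \<times> A \<times> A"]) (use fin in auto)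
    \<comment> \<open>Quadruples with value 0 are few: since b is nonzero, b, b' and a' determine
      a.\<close>
    define Z where "Z = {q \<in> V. x q = 0}"
    have "card Z \<le> card (B \<times> B \<times> A)"
    proof (rule card_inj_on_le)
      let ?g = "\<lambda>(b, b', a, a'). (b, b', a') :: real \<times> real \<times> real"
      show "inj_on ?g Z"
      proof (rule inj_onI, clarsimp simp: Z_def V_def x_def)
        fix b b' a a' e assume "b \<in> B" "b * a = b' * a'" "b * e = b' * a'"
        then show "a = e" using \<open>0 \<notin> B\<close> by (metis mult_left_cancel)
      qed
      show "?g ` Z \<subseteq> B \<times> B \<times> A" by (auto simp: Z_def V_def)
    qed (use fin in simp)
    then have Z: "card Z \<le> card B ^ 2 * ?n"
      by (simp add: card_cartesian_product power2_eq_square)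
    have "(\<Sum>q\<in>V. of_bool (k \<le> difference_reps A (x q))) = card {q \<in> V. k \<le> difference_reps A (x q)}"
      using finV by (simp add: sum_of_bool_eq Int_def)
    also have "\<dots> \<le> card (Z \<union> Sigma B (?G k))"
    proof (rule card_mono)
      show "finite (Z \<union> Sigma B (?G k))" using finV fin finG by (auto simp: Z_def)
      show "{q \<in> V. k \<le> difference_reps A (x q)} \<subseteq> Z \<union> Sigma B (?G k)"
        by (auto simp: Z_def V_def x_def popular_differences_def)
    qed
    also have "\<dots> \<le> card Z + card (Sigma B (?G k))" by (rule card_Un_le)
    also have "card (Sigma B (?G k)) = (\<Sum>b\<in>B. card (?G k b))"
      using fin finG by (subst card_SigmaI) auto
    finally show "(\<Sum>q\<in>V. of_bool (k \<le> difference_reps A (x q)))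
        \<le> card B ^ 2 * ?n + (\<Sum>b\<in>B. card (?G k b))" using Z by linarith
  qed
  also have "\<dots> = card B ^ 2 * card A ^ 2 + (\<Sum>k=1..?n. \<Sum>b\<in>B. card (?G k b))"
    by (simp add: sum.distrib power2_eq_square)
  finally show ?thesis .
qed

text \<open>Inserting the bound for popular differences into the count of dilated differences gives
  at most w/k solutions for each level \<open>k\<close> and each \<open>b\<close>. The sum over
  \<open>k\<close> is then harmonic, so only a logarithm is lost, and Cauchy--Schwarz compares the
  result with (|B||A|^2)^2/|C|. The last two alternatives are the cases of quadratic growth.\<close>

lemma product_sum_expansion_polynomial:
  fixes A B :: "real set"
  defines "n \<equiv> real (card A)" and "m \<equiv> real (card B)" and "N \<equiv> real (card (A * B + A))"
  assumes fin: "finite A" "finite B" and B: "0 \<notin> B" "B \<noteq> {}" "card B \<le> card A"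
  shows "n ^ 11 * m ^ 6 \<le> 8 * (216 * 72 ^ 5) * N ^ 11 * harm (card A) ^ 3
    \<or> n * m ^ 3 \<le> 2592 * N ^ 2 \<or> n ^ 2 \<le> 2 * N"
proof (rule ccontr)
  assume "\<not> ?thesis"
  then have neg: "n ^ 11 * m ^ 6 > 8 * (216 * 72 ^ 5) * N ^ 11 * harm (card A) ^ 3"
    "n * m ^ 3 > 2592 * N ^ 2" "n ^ 2 > 2 * N" by auto
  define C where "C = A * B + A"
  define H where "H = (harm (card A) :: real)"
  \<comment> \<open>\<open>w ^ 3\<close> is the product of the two bounds with the factor
    \<open>real k ^ 3\<close> cleared: the power k^(-3/2) of the popular differences enters to the
    power 2/3 and becomes 1/k.\<close>
  define w where "w = root 3 (216 * 72 ^ 5 * n * N ^ 8 / m ^ 3)"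
  define G where "G = (\<lambda>k b. {(b', a, a'). b' \<in> B \<and> a \<in> A \<and> a' \<in> A
      \<and> b * a - b' * a' \<in> popular_differences A k})"
  have finC: "finite C" unfolding C_def using fin by (intro finite_set_plus finite_set_times)
  have m: "m > 0" and n: "n > 0" and N0: "N \<ge> 0"
    using B fin by (auto simp: m_def n_def N_def card_gt_0_iff)
  have w3: "w ^ 3 = 216 * 72 ^ 5 * n * N ^ 8 / m ^ 3"
    unfolding w_def using m n N0 by (intro real_root_pow_pos2) auto
  have w0: "w \<ge> 0" unfolding w_def using m n N0 by simp
  have G: "real (card (G k b)) \<le> w * inverse (real k)" if k: "k \<in> {1..card A}" and b: "b \<in> B" for k b
  proof -
    define D where "D = real (card (popular_differences A k))"
    have k0: "real k \<ge> 1" using k by simp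
    have "n * m ^ 3 * 1 \<le> n * m ^ 3 * k" using k0 m n by (intro mult_left_mono) auto
    \<comment> \<open>Negating the second alternative at level 1 rules it out at every level
      \<open>k\<close>.\<close>
    then have "\<not> n * m ^ 3 * k \<le> 2592 * N ^ 2" using neg(2) by linarith
    then have D: "D ^ 2 * n ^ 3 * m ^ 5 * real k ^ 3 \<le> 72 ^ 5 * N ^ 8"
      using card_popular_differences_bound[OF fin B, of k] k by (auto simp: D_def n_def m_def N_def)
    have "real (card (G k b)) ^ 3 \<le> 216 * n ^ 4 * m ^ 2 * D ^ 2"
      unfolding G_def n_def m_def D_def
      by (rule card_dilated_differences_in_bound)
        (use fin B b k finite_popular_differences card_popular_differences_le in auto)
    then have "real (card (G k b)) ^ 3 * real k ^ 3 \<le> (216 * n ^ 4 * m ^ 2 * D ^ 2) * real k ^ 3"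
      by (rule mult_right_mono) simp
    also have "\<dots> = (216 * n / m ^ 3) * (D ^ 2 * n ^ 3 * m ^ 5 * real k ^ 3)"
      using m by (simp add: field_simps flip: power_add power_Suc)
    also have "\<dots> \<le> (216 * n / m ^ 3) * (72 ^ 5 * N ^ 8)"
      by (rule mult_left_mono[OF D]) (use m n in simp)
    also have "\<dots> = w ^ 3" by (simp add: w3)
    finally have "(real (card (G k b)) * real k) ^ 3 \<le> w ^ 3" by (simp add: power_mult_distrib)
    then have "real (card (G k b)) * real k \<le> w"
      using w0 by (simp add: power_mono_iff)
    then show ?thesis using k0 by (simp add: field_simps)
  qed
  let ?h = "\<lambda>(b, a, e). a * b + e :: real"
  let ?T = "B \<times> A \<times> A"
  have "real (card {(t, t'). t \<in> ?T \<and> t' \<in> ?T \<and> ?h t = ?h t'})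
      \<le> real (card B ^ 2 * card A ^ 2 + (\<Sum>k=1..card A. \<Sum>b\<in>B. card (G k b)))"
    using collisions_le_sum_popular[OF fin B(1)] unfolding G_def of_nat_le_iff .
  also have "\<dots> = m ^ 2 * n ^ 2 + (\<Sum>k=1..card A. \<Sum>b\<in>B. real (card (G k b)))"
    by (simp add: m_def n_def)
  also have "\<dots> \<le> m ^ 2 * n ^ 2 + (\<Sum>k=1..card A. \<Sum>b\<in>B. w * inverse (real k))"
    by (intro add_left_mono sum_mono G)
  also have "\<dots> = m ^ 2 * n ^ 2 + m * w * H"
    by (simp add: H_def harm_def m_def sum_distrib_left mult.assoc)
  finally have col: "real (card {(t, t'). t \<in> ?T \<and> t' \<in> ?T \<and> ?h t = ?h t'})
      \<le> m ^ 2 * n ^ 2 + m * w * H" .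
  have "?h ` ?T \<subseteq> C" by (auto simp: C_def intro!: set_plus_intro set_times_intro)
  from card_power2_le_collisions[OF _ finC this]
  have "real (card ?T ^ 2) \<le> real (card C * card {(t, t'). t \<in> ?T \<and> t' \<in> ?T \<and> ?h t = ?h t'})"
    unfolding of_nat_le_iff using fin by blast
  then have "(m * n ^ 2) ^ 2 \<le> N * real (card {(t, t'). t \<in> ?T \<and> t' \<in> ?T \<and> ?h t = ?h t'})"
    by (simp add: card_cartesian_product m_def n_def N_def C_def power2_eq_square)
  also have "\<dots> \<le> N * (m ^ 2 * n ^ 2 + m * w * H)"
    by (rule mult_left_mono[OF col N0])
  finally have main: "(m * n ^ 2) ^ 2 \<le> N * (m ^ 2 * n ^ 2) + N * (m * w * H)"
    by (simp add: algebra_simps)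
  \<comment> \<open>Negating the third alternative makes the contribution of the value 0 at most
    half of the left side, so the popular differences carry the rest.\<close>
  have "2 * (N * (m ^ 2 * n ^ 2)) \<le> (m * n ^ 2) ^ 2"
  proof -
    have "(2 * N) * (m ^ 2 * n ^ 2) \<le> n ^ 2 * (m ^ 2 * n ^ 2)"
      using neg(3) by (intro mult_right_mono) auto
    then show ?thesis by (simp add: power2_eq_square algebra_simps)
  qed
  then have "(m * n ^ 2) ^ 2 \<le> 2 * (N * (m * w * H))" using main by linarith
  then have "m * (m * n ^ 4) \<le> m * (2 * (N * w * H))"
    by (simp add: power2_eq_square power4_eq_xxxx algebra_simps)
  then have "m * n ^ 4 \<le> 2 * (N * w * H)" by (rule mult_left_le_imp_le) (rule m)
  then have "(m * n ^ 4) ^ 3 \<le> (2 * (N * w * H)) ^ 3"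
    using m n by (intro power_mono) auto
  also have "\<dots> = 8 * (N ^ 3 * w ^ 3 * H ^ 3)" by (simp add: power_mult_distrib)
  finally have "(m * n ^ 4) ^ 3 * m ^ 3 \<le> 8 * (N ^ 3 * w ^ 3 * H ^ 3) * m ^ 3"
    using m by (intro mult_right_mono) auto
  then have "n ^ 12 * m ^ 6 \<le> n * (8 * (216 * 72 ^ 5) * N ^ 11 * H ^ 3)"
    using m unfolding w3 by (simp add: power_mult_distrib field_simps flip: power_mult power_add)
  moreover have "n ^ 12 * m ^ 6 = n * (n ^ 11 * m ^ 6)" by (simp flip: power_Suc)
  ultimately have "n * (n ^ 11 * m ^ 6) \<le> n * (8 * (216 * 72 ^ 5) * N ^ 11 * H ^ 3)" by linarith
  then have "n ^ 11 * m ^ 6 \<le> 8 * (216 * 72 ^ 5) * N ^ 11 * H ^ 3"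
    by (rule mult_left_le_imp_le) (rule n)
  then show False using neg(1) by (simp add: H_def)
qed

section \<open>Arbitrary comparable sets and the logarithmic form\<close>

lemma harm_nat_ge_1: "n \<ge> 1 \<Longrightarrow> harm n \<ge> (1 :: real)"
  using harm_mono[of 1 n, where ?'a = real] by (simp add: harm_expand)

lemma harm_nat_le_ln:
  assumes "n \<ge> 2"
  shows "harm n \<le> 3 * ln (real n)"
proof -
  have "harm (Suc (n - 1)) - ln (real (Suc (n - 1))) \<le> harm (Suc 0) - ln (real (Suc 0))"
    using decseqD[OF decseq_harm_diff_ln, of 0 "n - 1"] by blast
  moreover have "harm (Suc 0) = (1 :: real)" by (simp add: harm_def)
  ultimately have "harm n \<le> 1 + ln (real n)" using assms by simp
  moreover have "ln 2 \<le> ln (real n)" using assms by simp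
  \<comment> \<open>Hence 1 \<le> 2 ln n, which turns 1 + ln n into the bound 3 ln n.\<close>
  moreover have "ln (2 :: real) \<ge> 1 / 2" using ln_le_minus_one[of "1 / 2 :: real"] by (simp add: ln_div)
  ultimately show ?thesis by linarith
qed

text \<open>This trivial bound serves the case of a one-element \<open>B\<close>, where deleting 0
  might leave nothing.\<close>

lemma card_le_card_product_sum:
  fixes A B :: "real set"
  assumes "finite A" "finite B" "b \<in> B"
  shows "card A \<le> card (A * B + A)"
proof (cases "A = {}")
  case False
  then obtain a where "a \<in> A" by auto
  show ?thesis
  proof (rule card_inj_on_le)
    show "inj_on (\<lambda>e. a * b + e) A" by (auto simp: inj_on_def)
    show "(\<lambda>e. a * b + e) ` A \<subseteq> A * B + A"
      using \<open>a \<in> A\<close> \<open>b \<in> B\<close> by (auto intro!: set_plus_intro set_times_intro)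
    show "finite (A * B + A)" using assms by (intro finite_set_plus finite_set_times)
  qed
qed simp

text \<open>Quadratic growth is brought into the shape of the main bound: its eleventh power has
  exponent 22, more than 17.\<close>

lemma power_17_le_of_square_le:
  fixes n N K :: real
  assumes "n \<ge> 1" "n ^ 2 \<le> K * N"
  shows "n ^ 17 \<le> K ^ 11 * N ^ 11"
proof -
  have "n ^ 17 \<le> n ^ 22" using assms by (intro power_increasing) auto
  also have "\<dots> = (n ^ 2) ^ 11" by (simp flip: power_mult)
  also have "\<dots> \<le> (K * N) ^ 11" using assms by (intro power_mono) auto
  finally show ?thesis by (simp add: power_mult_distrib)
qed

text \<open>The side conditions on \<open>B\<close> are arranged by deleting 0 and keeping at most
  |A| elements. This only shrinks \<open>A * B + A\<close> and costs a constant factor in |B| unless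
  |B| = 1, when |A| itself is bounded.\<close>

lemma product_sum_expansion:
  fixes c :: real
  assumes "c > 0"
  obtains K :: real where "K > 0"
    "\<And>A B :: real set. finite A \<Longrightarrow> finite B \<Longrightarrow> c * real (card A) \<le> real (card B) \<Longrightarrow>
      real (card A) ^ 17 \<le> K * real (card (A * B + A)) ^ 11 * harm (card A) ^ 3"
proof -
  \<comment> \<open>The half covers the deletion of 0 from a set with at least two elements; the cap
    1 covers the truncation to |A| elements.\<close>
  define d where "d = min 1 (c / 2)"
  have d: "0 < d" "d \<le> 1" "d \<le> c / 2" using assms by (auto simp: d_def)
  define q where "q = sqrt (2592 / d ^ 3)"
  have q: "q \<ge> 0" "q ^ 2 = 2592 / d ^ 3" using d by (auto simp: q_def)
  \<comment> \<open>One summand for each case: the main bound, the two quadratic alternatives, and a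
    one-element \<open>B\<close>.\<close>
  define K where "K = 8 * (216 * 72 ^ 5) / d ^ 6 + q ^ 11 + 2 ^ 11 + (1 / c) ^ 6"
  have Kge: "8 * (216 * 72 ^ 5) / d ^ 6 \<le> K" "q ^ 11 \<le> K" "2 ^ 11 \<le> K" "(1 / c) ^ 6 \<le> K"
    using d q assms by (auto simp: K_def)
  then have "K > 0" by (smt (verit) zero_less_power)
  show ?thesis
  proof (rule that[OF \<open>K > 0\<close>])
    fix A B :: "real set"
    assume fin: "finite A" "finite B" and cB: "c * real (card A) \<le> real (card B)"
    define n N H where "n = real (card A)" and "N = real (card (A * B + A))" and "H = (harm (card A) :: real)"
    have "n ^ 17 \<le> K * N ^ 11 * H ^ 3"
    proof (cases "A = {}")
      case True
      then show ?thesis by (simp add: n_def N_def H_def harm_def)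
    next
      case False
      then have cA: "card A \<ge> 1" using fin by (simp add: Suc_le_eq card_gt_0_iff)
      then have n1: "n \<ge> 1" by (simp add: n_def)
      have H1: "H \<ge> 1" using harm_nat_ge_1[OF cA] by (simp add: H_def)
      then have H3: "H ^ 3 \<ge> 1" by (rule one_le_power)
      have N0: "N \<ge> 0" by (simp add: N_def)
      \<comment> \<open>Bounds without a logarithm suffice, because the harmonic factor is at least
        1.\<close>
      have Hfree: "n ^ 17 \<le> K * N ^ 11 * H ^ 3" if "n ^ 17 \<le> k * N ^ 11" "k \<le> K" for k
      proof -
        have "n ^ 17 \<le> K * N ^ 11 * 1" using that N0 mult_right_mono[of k K "N ^ 11"] by simp
        also have "\<dots> \<le> K * N ^ 11 * H ^ 3" using H3 N0 \<open>K > 0\<close> by (intro mult_left_mono) auto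
        finally show ?thesis .
      qed
      have "c * n > 0" using assms n1 by simp
      then have B0: "card B \<noteq> 0" using cB by (simp add: n_def)
      then obtain b where b: "b \<in> B" by fastforce
      show ?thesis
      proof (cases "card B = 1")
        case True
        then have "n \<le> 1 / c" using cB assms by (simp add: n_def field_simps)
        then have "n ^ 6 \<le> (1 / c) ^ 6" using n1 by (intro power_mono) auto
        moreover have "n ^ 11 \<le> N ^ 11"
          using card_le_card_product_sum[OF fin b] by (intro power_mono) (auto simp: n_def N_def)
        ultimately have "n ^ 6 * n ^ 11 \<le> (1 / c) ^ 6 * N ^ 11"
          using n1 assms by (intro mult_mono) auto
        then have "n ^ 17 \<le> (1 / c) ^ 6 * N ^ 11" by (simp flip: power_add)
        then show ?thesis by (rule Hfree) (rule Kge)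
      next
        case False
        have dB: "card (B - {0}) \<ge> card B - 1"
          by (simp add: card_Diff_singleton_if)
        obtain B' where B': "B' \<subseteq> B - {0}" "card B' = min (card A) (card (B - {0}))"
          by (meson min.cobounded2 obtain_subset_with_card_n)
        have finB': "finite B'" using B' fin by (meson finite_Diff finite_subset)
        define m where "m = real (card B')"
        have "d * n \<le> real (card (B - {0}))"
        proof -
          have "d * n \<le> c / 2 * n" using d n1 by (intro mult_right_mono) auto
          also have "\<dots> \<le> real (card B) / 2" using cB by (simp add: n_def)
          also have "\<dots> \<le> real (card B - 1)" using B0 False by simp
          finally show ?thesis using dB by linarith
        qed
        moreover have "d * n \<le> n" using d n1 by (simp add: mult_le_cancel_right1)
        ultimately have dm: "d * n \<le> m" using B'(2) by (simp add: m_def n_def min_def)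
        have "d * n > 0" using d n1 by simp
        then have "m > 0" using dm by linarith
        then have "B' \<noteq> {}" by (auto simp: m_def)
        define N' where "N' = real (card (A * B' + A))"
        have "card (A * B' + A) \<le> card (A * B + A)"
        proof (rule card_mono)
          show "finite (A * B + A)" using fin by (intro finite_set_plus finite_set_times)
          show "A * B' + A \<subseteq> A * B + A" using B' by (intro set_plus_mono2 set_times_mono2) auto
        qed
        then have N': "N' \<le> N" "N' \<ge> 0" by (simp_all add: N_def N'_def)
        have "n ^ 11 * m ^ 6 \<le> 8 * (216 * 72 ^ 5) * N' ^ 11 * H ^ 3
            \<or> n * m ^ 3 \<le> 2592 * N' ^ 2 \<or> n ^ 2 \<le> 2 * N'"
          unfolding n_def m_def N'_def H_def
          by (rule product_sum_expansion_polynomial) (use fin finB' B' \<open>B' \<noteq> {}\<close> in auto)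
        then consider "n ^ 11 * m ^ 6 \<le> 8 * (216 * 72 ^ 5) * N' ^ 11 * H ^ 3"
          | "n * m ^ 3 \<le> 2592 * N' ^ 2" | "n ^ 2 \<le> 2 * N'" by blast
        then show ?thesis
        proof cases
          case 1
          have "n ^ 11 * (d * n) ^ 6 \<le> n ^ 11 * m ^ 6"
            using dm d n1 by (intro mult_left_mono power_mono) auto
          also note 1
          also have "8 * (216 * 72 ^ 5) * N' ^ 11 * H ^ 3 \<le> 8 * (216 * 72 ^ 5) * N ^ 11 * H ^ 3"
            using N' H1 by (intro mult_right_mono mult_left_mono power_mono) auto
          also have "n ^ 11 * (d * n) ^ 6 = n ^ 17 * d ^ 6"
            by (simp add: power_mult_distrib mult_ac flip: power_add)
          finally have "n ^ 17 \<le> 8 * (216 * 72 ^ 5) / d ^ 6 * (N ^ 11 * H ^ 3)"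
            using d by (simp add: pos_le_divide_eq mult.assoc)
          also have "\<dots> \<le> K * (N ^ 11 * H ^ 3)"
            using Kge(1) N0 H1 by (intro mult_right_mono) auto
          finally show ?thesis by (simp add: mult.assoc)
        next
          case 2
          have "n * (d * n) ^ 3 \<le> n * m ^ 3"
            using dm d n1 by (intro mult_left_mono power_mono) auto
          also note 2
          also have "2592 * N' ^ 2 \<le> 2592 * N ^ 2" using N' by (intro mult_left_mono power_mono) auto
          finally have "n ^ 4 * d ^ 3 \<le> 2592 * N ^ 2"
            by (simp add: power_mult_distrib power3_eq_cube power4_eq_xxxx mult_ac)
          then have "n ^ 4 \<le> 2592 / d ^ 3 * N ^ 2" using d by (simp add: pos_le_divide_eq)
          then have "(n ^ 2) ^ 2 \<le> (q * N) ^ 2" by (simp add: power_mult_distrib q(2))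
          then have "n ^ 2 \<le> q * N" by (rule power2_le_imp_le) (use q N0 in simp)
          then have "n ^ 17 \<le> q ^ 11 * N ^ 11" by (rule power_17_le_of_square_le[OF n1])
          then show ?thesis by (rule Hfree) (rule Kge)
        next
          case 3
          then have "n ^ 2 \<le> 2 * N" using N' by linarith
          then have "n ^ 17 \<le> 2 ^ 11 * N ^ 11" by (rule power_17_le_of_square_le[OF n1])
          then show ?thesis by (rule Hfree) (rule Kge)
        qed
      qed
    qed
    then show "real (card A) ^ 17 \<le> K * real (card (A * B + A)) ^ 11 * harm (card A) ^ 3"
      by (simp add: n_def N_def H_def)
  qed
qed

theorem theorem11:
  fixes c\<^sub>1 c\<^sub>2 :: real
  assumes "0 < c\<^sub>1" and "c\<^sub>1 \<le> c\<^sub>2"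
  shows "\<exists>c > 0. \<exists>C > 0. \<forall>A B :: real set.
           finite A \<longrightarrow> finite B \<longrightarrow>
           c\<^sub>1 * real (card A) \<le> real (card B) \<longrightarrow> real (card B) \<le> c\<^sub>2 * real (card A) \<longrightarrow>
           real (card (A * B + A))
             \<ge> c * real (card A) powr (3 / 2 + 3 / 170) / ln (real (card A)) powr C"
proof -
  obtain K :: real where K: "K > 0"
    "\<And>A B :: real set. finite A \<Longrightarrow> finite B \<Longrightarrow> c\<^sub>1 * real (card A) \<le> real (card B) \<Longrightarrow>
      real (card A) ^ 17 \<le> K * real (card (A * B + A)) ^ 11 * harm (card A) ^ 3"
    using product_sum_expansion[OF assms(1)] by blast
  \<comment> \<open>The eleventh root matches the power of \<open>N\<close>; the 27 comes from
    cubing the bound 3 ln n for the harmonic number.\<close>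
  define c where "c = (1 / (27 * K)) powr (1 / 11)"
  have c: "c > 0" "c ^ 11 = 1 / (27 * K)"
    using K(1) by (simp_all add: c_def powr_power)
  have "real (card (A * B + A)) \<ge> c * real (card A) powr (3 / 2 + 3 / 170) / ln (real (card A)) powr (3 / 11)"
    if fin: "finite A" "finite B" and cB: "c\<^sub>1 * real (card A) \<le> real (card B)" for A B :: "real set"
  proof (cases "card A \<ge> 2")
    \<comment> \<open>The right side is 0 here: for an empty \<open>A\<close> the numerator
      vanishes, and for a singleton \<open>ln 1 = 0\<close> makes the denominator
      \<open>0 powr (3 / 11) = 0\<close>, and division by 0 yields 0.\<close>
    case False
    then have "card A = 0 \<or> card A = 1" by linarith
    then show ?thesis by auto
  next
    case True
    define n N l where "n = real (card A)" and "N = real (card (A * B + A))" and "l = ln (real (card A))"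
    have n: "n \<ge> 2" and l: "l > 0" using True by (auto simp: n_def l_def)
    have "n ^ 17 \<le> K * N ^ 11 * harm (card A) ^ 3" using K(2)[OF fin cB] by (simp add: n_def N_def)
    also have "\<dots> \<le> K * N ^ 11 * (3 * l) ^ 3"
      using harm_nat_le_ln[OF True] K(1)
      by (intro mult_left_mono power_mono) (auto simp: l_def N_def harm_nonneg)
    finally have main: "n ^ 17 \<le> 27 * K * N ^ 11 * l ^ 3" by (simp add: power_mult_distrib mult_ac)
    have "(c * n powr (3 / 2 + 3 / 170) / l powr (3 / 11)) ^ 11
        = (1 / (27 * K)) * n powr (11 * (3 / 2 + 3 / 170)) / l ^ 3"
      using n l by (simp add: power_mult_distrib power_divide c powr_power mult.commute)
    \<comment> \<open>The exponent is 16.5 + 33/170, which is less than 17.\<close>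
    also have "\<dots> \<le> (1 / (27 * K)) * n powr 17 / l ^ 3"
      using n l K(1) by (intro divide_right_mono mult_left_mono powr_mono) auto
    also have "\<dots> \<le> N ^ 11"
      using main n l K(1) by (simp add: powr_numeral field_simps)
    \<comment> \<open>Eleventh roots are taken; the instance 10 in the rule stands for the exponent
      \<open>Suc 10\<close>.\<close>
    finally have "c * n powr (3 / 2 + 3 / 170) / l powr (3 / 11) \<le> N"
      by (rule power_le_imp_le_base[of _ 10, simplified]) (simp_all add: N_def)
    then show ?thesis by (simp add: n_def N_def l_def)
  qed
  then show ?thesis
    using c(1) by (intro exI[of _ c] conjI exI[of _ "3 / 11 :: real"] allI impI) auto
qed

end
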